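(* Let $X$ be an almost $P$-space. Then every dense subspace of $X$ is Volterra and every open subspace of $X$ is Volterra.
   Context: A subset of a topological space is a $G_\delta$ set if it is a countable intersection of open sets. A topological space $X$ is an almost $P$-space if every non-empty $G_\delta$ subset of $X$ has non-empty interior. A topological space $Y$ is Volterra if for every pair $G, H$ of dense $G_\delta$ subsets of $Y$, the set $G \cap H$ is dense in $Y$. Subsets of $X$ are regarded as spaces with the subspace topology. No separation axioms are assumed. *)

theory Defs
  imports "HOL-Analysis.Analysis"
begin

text \<open>The inclusion has to be stated: \<open>X closure_of S\<close> only depends on
  \<open>topspace X \<inter> S\<close>.\<close>

definition dense_in :: "'a topology \<Rightarrow> 'a set \<Rightarrow> bool"
  where "dense_in X S \<longleftrightarrow> S \<subseteq> topspace X \<and> X closure_of S = topspace X"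

definition almost_P_space :: "'a topology \<Rightarrow> bool"
  where "almost_P_space X \<longleftrightarrow>
    (\<forall>G. gdelta_in X G \<and> G \<noteq> {} \<longrightarrow> X interior_of G \<noteq> {})"

definition Volterra_space :: "'a topology \<Rightarrow> bool"
  where "Volterra_space Y \<longleftrightarrow>
    (\<forall>G H. gdelta_in Y G \<and> dense_in Y G \<and> gdelta_in Y H \<and> dense_in Y H
       \<longrightarrow> dense_in Y (G \<inter> H))"

end

theory Submission
  imports Defs
begin

text \<open>
  Dense subspaces and open subspaces are treated together, through the sets \<open>D\<close> that are
  contained in the interior \<open>O'\<close> of their closure
  (\<open>Volterra_subtopology_if_subset_interior_closure\<close>). For such a \<open>D\<close>, every non-empty open
  subset of \<open>O'\<close> meets \<open>D\<close>, and hence meets every dense subset of \<open>D\<close>.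

  Two dense \<open>G\<^sub>\<delta>\<close> subsets of \<open>D\<close> are traces on \<open>D\<close> of \<open>G\<^sub>\<delta>\<close> sets \<open>A\<close> and \<open>B\<close> of \<open>X\<close>. Let \<open>U\<close>
  be a non-empty open subset of \<open>O'\<close>. Then \<open>U \<inter> A\<close> is a non-empty \<open>G\<^sub>\<delta>\<close> set, so the almost \<open>P\<close>
  property yields a non-empty open set \<open>V \<subseteq> U \<inter> A\<close>
  (\<open>almost_P_space_open_subset_Int_gdelta\<close>). Since \<open>V\<close> still lies in \<open>O'\<close>, it meets \<open>B\<close>, and
  in the same way \<open>V \<inter> B\<close> contains a non-empty open set \<open>W\<close>. Finally \<open>W\<close> meets \<open>D\<close>, which gives
  a point of \<open>U \<inter> D \<inter> A \<inter> B\<close>. What makes this work is that \<open>A\<close> and \<open>B\<close> share a non-empty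
  \<^emph>\<open>open\<close> set inside \<open>U\<close>, and \<open>D\<close> cannot avoid an open set there.
\<close>

lemma dense_in_subtopology_iff_meets_open:
  assumes "D \<subseteq> topspace X"
  shows "dense_in (subtopology X D) S \<longleftrightarrow>
    S \<subseteq> D \<and> (\<forall>U. openin X U \<and> U \<inter> D \<noteq> {} \<longrightarrow> U \<inter> S \<noteq> {})"
proof -
  have top: "topspace (subtopology X D) = D"
    using assms by auto
  have trace: "S \<inter> (U \<inter> D) = U \<inter> S" if "S \<subseteq> D" for U
    using that by auto
  have "(\<forall>T. openin (subtopology X D) T \<and> T \<noteq> {} \<longrightarrow> S \<inter> T \<noteq> {}) \<longleftrightarrow>
      (\<forall>U. openin X U \<longrightarrow> U \<inter> D \<noteq> {} \<longrightarrow> S \<inter> (U \<inter> D) \<noteq> {})"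
  proof (intro iffI allI impI)
    fix U
    assume *: "\<forall>T. openin (subtopology X D) T \<and> T \<noteq> {} \<longrightarrow> S \<inter> T \<noteq> {}"
      and "openin X U" "U \<inter> D \<noteq> {}"
    then have "openin (subtopology X D) (U \<inter> D)"
      by (simp add: openin_subtopology_Int)
    with * \<open>U \<inter> D \<noteq> {}\<close> show "S \<inter> (U \<inter> D) \<noteq> {}"
      by simp
  next
    fix T
    assume *: "\<forall>U. openin X U \<longrightarrow> U \<inter> D \<noteq> {} \<longrightarrow> S \<inter> (U \<inter> D) \<noteq> {}"
      and T: "openin (subtopology X D) T \<and> T \<noteq> {}"
    then obtain U where "openin X U" "T = U \<inter> D"
      by (meson openin_subtopology)
    with * T show "S \<inter> T \<noteq> {}"
      by simp
  qed
  then show ?thesis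
    unfolding dense_in_def dense_intersects_open
    by (simp add: top trace imp_conjL del: topspace_subtopology cong: conj_cong)
qed

text \<open>The form in which the almost \<open>P\<close> property is iterated: intersecting a non-empty open set
  with a \<open>G\<^sub>\<delta>\<close> set that it meets leads to a smaller non-empty open set.\<close>

lemma almost_P_space_open_subset_Int_gdelta:
  assumes "almost_P_space X" "openin X U" "gdelta_in X A" "U \<inter> A \<noteq> {}"
  obtains V where "openin X V" "V \<noteq> {}" "V \<subseteq> U \<inter> A"
proof -
  have "gdelta_in X (U \<inter> A)"
    using assms by (simp add: gdelta_in_Int open_imp_gdelta_in)
  with assms have "X interior_of (U \<inter> A) \<noteq> {}"
    unfolding almost_P_space_def by blast
  then show thesis
    by (rule that[OF openin_interior_of _ interior_of_subset])
qed

text \<open>The hypothesis on \<open>D\<close> is the common generalization of density and openness: each point of \<open>D\<close>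
  has a neighbourhood all of whose non-empty open subsets meet \<open>D\<close>.\<close>

lemma Volterra_subtopology_if_subset_interior_closure:
  assumes X: "almost_P_space X"
    and D: "D \<subseteq> X interior_of (X closure_of D)"
  shows "Volterra_space (subtopology X D)"
  unfolding Volterra_space_def
proof (intro allI impI, elim conjE)
  fix G H
  assume gdG: "gdelta_in (subtopology X D) G" and dG: "dense_in (subtopology X D) G"
    and gdH: "gdelta_in (subtopology X D) H" and dH: "dense_in (subtopology X D) H"
  define O' where "O' = X interior_of (X closure_of D)"
  have DX: "D \<subseteq> topspace X"
    using D interior_of_subset_topspace[of X] by (rule order_trans)
  have openO: "openin X O'"
    unfolding O'_def by (rule openin_interior_of)
  have DO: "D \<subseteq> O'"
    unfolding O'_def by (rule D)
  have O'_closure: "O' \<subseteq> X closure_of D"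
    unfolding O'_def by (rule interior_of_subset)
  \<comment> \<open>An open set that misses \<open>D\<close> also misses the closure of \<open>D\<close>.\<close>
  have meets_D: "U \<inter> D \<noteq> {}" if "openin X U" "U \<noteq> {}" "U \<subseteq> O'" for U
  proof -
    have "U \<inter> X closure_of D \<noteq> {}"
      using that(2,3) O'_closure by blast
    then show ?thesis
      using that(1) by (simp add: openin_Int_closure_of_eq_empty)
  qed
  have meets_dense: "U \<inter> S \<noteq> {}"
    if "openin X U" "U \<noteq> {}" "U \<subseteq> O'" "dense_in (subtopology X D) S" for U S
    using meets_D[OF that(1-3)] that(1,4) unfolding dense_in_subtopology_iff_meets_open[OF DX] by blast
  obtain A where A: "gdelta_in X A" "G = A \<inter> D"
    using gdG unfolding gdelta_in_subtopology by blast
  obtain B where B: "gdelta_in X B" "H = B \<inter> D"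
    using gdH unfolding gdelta_in_subtopology by blast
  \<comment> \<open>A given \<open>U\<close> is first cut down to \<open>U \<inter> O'\<close>, since only inside \<open>O'\<close> do all non-empty
    open sets meet \<open>D\<close>.\<close>
  have "U \<inter> (G \<inter> H) \<noteq> {}" if U: "openin X U" "U \<inter> D \<noteq> {}" for U
  proof -
    have U': "openin X (U \<inter> O')" "U \<inter> O' \<noteq> {}"
      using U openO DO by auto
    have "(U \<inter> O') \<inter> A \<noteq> {}"
      using meets_dense[OF U' _ dG] A(2) by blast
    then obtain V where V: "openin X V" "V \<noteq> {}" "V \<subseteq> (U \<inter> O') \<inter> A"
      using almost_P_space_open_subset_Int_gdelta[OF X U'(1) A(1)] by blast
    have "V \<inter> B \<noteq> {}"
      using meets_dense[OF V(1,2) _ dH] V(3) B(2) by blast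
    then obtain W where W: "openin X W" "W \<noteq> {}" "W \<subseteq> V \<inter> B"
      using almost_P_space_open_subset_Int_gdelta[OF X V(1) B(1)] by blast
    have "W \<inter> D \<noteq> {}"
      using meets_D[OF W(1,2)] W(3) V(3) by blast
    then show ?thesis
      using W(3) V(3) A(2) B(2) by blast
  qed
  moreover have "G \<inter> H \<subseteq> D"
    using A(2) by blast
  ultimately show "dense_in (subtopology X D) (G \<inter> H)"
    by (simp add: dense_in_subtopology_iff_meets_open[OF DX])
qed

theorem proposition2p4:
  fixes X :: "'a topology"
  assumes "almost_P_space X"
  shows "(\<forall>D. dense_in X D \<longrightarrow> Volterra_space (subtopology X D)) \<and>
         (\<forall>U. openin X U \<longrightarrow> Volterra_space (subtopology X U))"
proof (intro conjI allI impI)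
  fix D assume "dense_in X D"
  then have "D \<subseteq> X interior_of (X closure_of D)"
    by (simp add: dense_in_def)
  then show "Volterra_space (subtopology X D)"
    by (rule Volterra_subtopology_if_subset_interior_closure[OF assms])
next
  fix U assume U: "openin X U"
  then have "U \<subseteq> X interior_of (X closure_of U)"
    by (simp add: interior_of_maximal closure_of_subset openin_subset)
  then show "Volterra_space (subtopology X U)"
    by (rule Volterra_subtopology_if_subset_interior_closure[OF assms])
qed

end
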